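(* Let $q$ be a prime power and let $k$ be a positive integer. Let $\beta_k\in\mathbb{F}_q(t)[X]$ denote the $k$-th Carlitz binomial polynomial and let $\operatorname{Int}(\mathbb{F}_q[t])=\{f\in\mathbb{F}_q(t)[X] \mid f(\mathbb{F}_q[t])\subseteq\mathbb{F}_q[t]\}$. Then the following hold. (1) $\beta_k$ is irreducible in $\operatorname{Int}(\mathbb{F}_q[t])$ if and only if $k=q^s$ for some non-negative integer $s$. More precisely, there is a decomposition $$\beta_k=\prod_{i=0}^{s}(\beta_{q^i})^{\alpha_i},$$ where $k=\alpha_0+\alpha_1 q+\dots+\alpha_s q^s$ with $\alpha_i\in\{0,\dots,q-1\}$, $\alpha_s\neq 0$ and $s$ a non-negative integer. (2) For every non-negative integer $s$ and every positive integer $m$, the $m$-th power $\beta_{q^s}^m$ of the irreducible element $\beta_{q^s}$ factors uniquely as a product of irreducible elements of $\operatorname{Int}(\mathbb{F}_q[t])$. In other words, $\beta_{q^s}$ is absolutely irreducible in $\operatorname{Int}(\mathbb{F}_q[t])$.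
   Context: Let $q$ be a prime power, $\mathbb{F}_q$ the finite field with $q$ elements, and $t$, $X$ independent variables over $\mathbb{F}_q$. Put $\deg(0)=-\infty$. Define $$\psi_0(X)=X,\qquad \psi_m(X)=\prod_{\substack{f\in\mathbb{F}_q[t]\\ \deg(f)<m}}(X-f)\quad (m\ge 1),$$ $$F_0=1,\qquad F_m=(t^{q^m}-t)(t^{q^{m-1}}-t)^{q}\cdots(t^q-t)^{q^{m-1}}\quad (m\ge 1).$$ For a non-negative integer $k$ with $q$-ary digit representation $k=\alpha_0+\alpha_1q+\dots+\alpha_sq^s$, $\alpha_i\in\{0,\dots,q-1\}$, define $$G_k(X)=\psi_0(X)^{\alpha_0}\cdots\psi_s(X)^{\alpha_s},\qquad g_k=F_0^{\alpha_0}\cdots F_s^{\alpha_s},\qquad \beta_k(X)=\frac{G_k(X)}{g_k}\in\mathbb{F}_q(t)[X].$$ The polynomial $\beta_k$ is called the $k$-th Carlitz binomial polynomial; it lies in the ring $\operatorname{Int}(\mathbb{F}_q[t])$ of integer-valued polynomials on $\mathbb{F}_q[t]$ (an integral domain, a subring of $\mathbb{F}_q(t)[X]$). An element of an integral domain is irreducible if it is a non-zero non-unit that is not a product of two non-units. Unique factorization of an element as a product of irreducible elements is understood up to the order of the factors and multiplication of the factors by units. An irreducible element $r$ is called absolutely irreducible if for every positive integer $m$ the power $r^m$ factors uniquely as a product of irreducible elements (so that the only such factorization is $r\cdots r$). *)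

theory Defs
  imports "HOL-Library.Cardinality" "HOL-Algebra.Ring_Divisibility"
    "HOL-Computational_Algebra.Polynomial_Factorial"
begin

section \<open>The ring of integer-valued polynomials\<close>

definition int_valued_ring :: "'d::idom fract poly ring" where
  "int_valued_ring =
     \<lparr>carrier = {p. \<forall>a. poly p (to_fract a) \<in> range to_fract},
      mult = (*), one = 1, zero = 0, add = (+)\<rparr>"

lemma domain_int_valued_ring: "domain (int_valued_ring :: 'd::idom fract poly ring)"
proof -
  let ?R = "int_valued_ring :: 'd fract poly ring"
  have add: "x + y \<in> range to_fract" and mul: "x * y \<in> range to_fract"
    and neg: "- x \<in> range to_fract"
    if "x \<in> range to_fract" "y \<in> range to_fract" for x y :: "'d fract"
    using that by (auto simp flip: to_fract_add to_fract_mult to_fract_uminus)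
  have [simp]: "(0 :: 'd fract) \<in> range to_fract" "(1 :: 'd fract) \<in> range to_fract"
    by (auto intro!: image_eqI[of _ _ 0] image_eqI[of _ _ 1])
  have ab: "abelian_group ?R"
  proof (rule abelian_groupI)
    fix x assume "x \<in> carrier ?R"
    then show "\<exists>y\<in>carrier ?R. y \<oplus>\<^bsub>?R\<^esub> x = \<zero>\<^bsub>?R\<^esub>"
      by (intro bexI[of _ "- x"]) (auto simp: int_valued_ring_def intro!: neg)
  qed (auto simp: int_valued_ring_def add ac_simps)
  have cm: "Group.comm_monoid ?R"
    by (rule comm_monoidI) (auto simp: int_valued_ring_def mul ac_simps)
  have cr: "cring ?R"
    using ab cm by (rule cringI) (auto simp: int_valued_ring_def algebra_simps)
  show ?thesis
    using cr by (rule domain.intro) (unfold_locales, auto simp: int_valued_ring_def)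
qed


section \<open>Unique factorization of an element\<close>

definition irreducible_factorization :: "('r, 'm) ring_scheme \<Rightarrow> 'r list \<Rightarrow> 'r \<Rightarrow> bool" where
  "irreducible_factorization R fs a \<longleftrightarrow>
     set fs \<subseteq> carrier R \<and> (\<forall>r\<in>set fs. ring_irreducible\<^bsub>R\<^esub> r) \<and>
     foldr (\<otimes>\<^bsub>R\<^esub>) fs \<one>\<^bsub>R\<^esub> = a"

definition factors_uniquely :: "('r, 'm) ring_scheme \<Rightarrow> 'r \<Rightarrow> bool" where
  "factors_uniquely R a \<longleftrightarrow>
     (\<exists>fs. irreducible_factorization R fs a) \<and>
     (\<forall>fs gs. irreducible_factorization R fs a \<longrightarrow> irreducible_factorization R gs a \<longrightarrow>
        essentially_equal R fs gs)"

definition absolutely_irreducible :: "('r, 'm) ring_scheme \<Rightarrow> 'r \<Rightarrow> bool" where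
  "absolutely_irreducible R r \<longleftrightarrow>
     r \<in> carrier R \<and> ring_irreducible\<^bsub>R\<^esub> r \<and> (\<forall>m::nat. m > 0 \<longrightarrow> factors_uniquely R (r [^]\<^bsub>R\<^esub> m))"

text \<open>
  \<^const>\<open>ring_irreducible\<close> is phrased with proper divisors; in a domain this is the usual notion.
\<close>

lemma (in domain) ring_irreducible_iff:
  assumes "r \<in> carrier R"
  shows "ring_irreducible r \<longleftrightarrow>
    r \<noteq> \<zero> \<and> r \<notin> Units R \<and>
    \<not> (\<exists>a\<in>carrier R. \<exists>b\<in>carrier R. a \<notin> Units R \<and> b \<notin> Units R \<and> r = a \<otimes> b)"
  using assms ring_irreducibleE[of r] ring_irreducibleI[of r] by blast


section \<open>Carlitz binomial polynomials\<close>

text \<open>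
  The field with \<open>q\<close> elements is a type \<open>'a\<close> with \<open>q = CARD('a)\<close>, and \<open>t\<close> is \<open>[:0, 1:] :: 'a poly\<close>.
  Since \<open>degree 0 = 0\<close>, the convention \<open>deg 0 = -\<infinity>\<close> is made explicit in the index set.
\<close>

definition carlitz_psi :: "nat \<Rightarrow> 'a::{field,finite} poly fract poly" where
  "carlitz_psi m = (\<Prod>f | f = 0 \<or> degree f < m. [:0, 1:] - [:to_fract f:])"

lemma finite_carlitz_psi_index: "finite {f :: 'a::{zero,finite} poly. f = 0 \<or> degree f < m}"
proof (rule finite_subset)
  show "{f :: 'a poly. f = 0 \<or> degree f < m} \<subseteq> Poly ` {xs. set xs \<subseteq> UNIV \<and> length xs \<le> m}"
  proof
    fix f :: "'a poly" assume "f \<in> {f. f = 0 \<or> degree f < m}"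
    then have "length (coeffs f) \<le> m"
      by (cases "f = 0") (auto simp: length_coeffs_degree)
    then show "f \<in> Poly ` {xs. set xs \<subseteq> UNIV \<and> length xs \<le> m}"
      by (intro image_eqI[of _ _ "coeffs f"]) auto
  qed
  show "finite (Poly ` {xs :: 'a list. set xs \<subseteq> UNIV \<and> length xs \<le> m})"
    by (intro finite_imageI finite_lists_length_le) simp
qed

lemma carlitz_psi_0: "carlitz_psi 0 = [:0, 1:]"
  by (simp add: carlitz_psi_def)

definition carlitz_F :: "nat \<Rightarrow> 'a::{field,finite} poly" where
  "carlitz_F m = (\<Prod>i<m. ([:0, 1:] ^ (CARD('a) ^ (m - i)) - [:0, 1:]) ^ (CARD('a) ^ i))"

definition digit :: "nat \<Rightarrow> nat \<Rightarrow> nat \<Rightarrow> nat" where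
  "digit q k i = (k div q ^ i) mod q"

text \<open>
  The products below run up to \<open>k\<close> instead of the last digit position: for \<open>i > k\<close> one has
  \<open>q ^ i > k\<close>, and vanishing digits contribute the factor 1.
\<close>

definition carlitz_G :: "nat \<Rightarrow> 'a::{field,finite} poly fract poly" where
  "carlitz_G k = (\<Prod>i\<le>k. carlitz_psi i ^ digit CARD('a) k i)"

definition carlitz_g :: "nat \<Rightarrow> 'a::{field,finite} poly" where
  "carlitz_g k = (\<Prod>i\<le>k. carlitz_F i ^ digit CARD('a) k i)"

definition carlitz_binomial :: "nat \<Rightarrow> 'a::{field,finite} poly fract poly" where
  "carlitz_binomial k = smult (inverse (to_fract (carlitz_g k))) (carlitz_G k)"

definition is_digit_expansion :: "nat \<Rightarrow> nat \<Rightarrow> nat \<Rightarrow> (nat \<Rightarrow> nat) \<Rightarrow> bool" where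
  "is_digit_expansion q k s \<alpha> \<longleftrightarrow>
     (\<forall>i\<le>s. \<alpha> i < q) \<and> \<alpha> s \<noteq> 0 \<and> k = (\<Sum>i\<le>s. \<alpha> i * q ^ i)"

end

theory Submission
  imports Defs
begin

text \<open>
  Write \<open>b\<^sub>s\<close> for the quotient of \<open>\<psi>\<^sub>s\<close> by \<open>F\<^sub>s\<close>, which is the binomial polynomial of index \<open>q ^ s\<close>.
  Since \<open>\<psi>\<^sub>s\<close> takes the value \<open>F\<^sub>s\<close> at every monic polynomial of degree \<open>s\<close>, a factor \<open>g\<close> of a power
  of \<open>b\<^sub>s\<close> takes unit values there. Up to a scalar, \<open>g\<close> is a product of linear factors \<open>X - f\<close>
  with \<open>deg f < s\<close>. Evaluating \<open>g\<close> at \<open>p + f\<close> for a fixed monic irreducible \<open>p\<close> of degree \<open>s\<close> and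
  comparing \<open>p\<close>-adic valuations shows that all these \<open>f\<close> have the same multiplicity in \<open>g\<close>. Hence
  \<open>g\<close> is a unit times a power of \<open>b\<^sub>s\<close>, which gives absolute irreducibility.
\<close>

section \<open>The Carlitz polynomials on polynomials over a finite field\<close>

lemma card_ge_2: "CARD('a::{field,finite}) \<ge> 2"
proof -
  have "card {0, 1 :: 'a} \<le> CARD('a)"
    by (intro card_mono) auto
  then show ?thesis by simp
qed

text \<open>Multiplication by a non-zero \<open>c\<close> permutes the non-zero elements; comparing
  their product before and after gives \<open>c ^ (q - 1) = 1\<close>.\<close>

lemma power_card_eq_self:
  fixes c :: "'a::{field,finite}"
  shows "c ^ CARD('a) = c"
proof (cases "c = 0")
  case True
  then show ?thesis using card_ge_2[where 'a = 'a] by simp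
next
  case False
  have "bij_betw (\<lambda>y. c * y) (UNIV - {0}) (UNIV - {0})"
    by (rule bij_betwI[where g = "\<lambda>y. y / c"]) (use False in auto)
  then have "(\<Prod>y\<in>UNIV - {0}. y) = (\<Prod>y\<in>UNIV - {0}. c * y)"
    by (simp add: prod.reindex_bij_betw[of _ _ _ "\<lambda>y. y"])
  also have "\<dots> = c ^ (CARD('a) - 1) * (\<Prod>y\<in>UNIV - {0}. y)"
    by (simp add: prod.distrib card_Diff_singleton)
  finally have "c ^ (CARD('a) - 1) = 1"
    by simp
  moreover have "CARD('a) = Suc (CARD('a) - 1)"
    using card_ge_2[where 'a = 'a] by simp
  ultimately show ?thesis
    by (metis mult.right_neutral power_Suc)
qed

text \<open>
  Both sides of $(X+1)^q = X^q + 1$ are monic of degree $q$ and agree at all $q$ elements of the field.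
\<close>
lemma of_nat_card_choose_eq_0:
  assumes "0 < i" "i < CARD('a)"
  shows "of_nat (CARD('a) choose i) = (0 :: 'a::{field,finite})"
proof -
  let ?q = "CARD('a)"
  have "[:1, 1:] ^ ?q = monom 1 ?q + (1 :: 'a poly)"
  proof (rule poly_eqI_degree_lead_coeff[where n = ?q and A = UNIV])
    show "coeff ([:1, 1:] ^ ?q) ?q = coeff (monom 1 ?q + (1 :: 'a poly)) ?q"
      using assms by (simp add: coeff_linear_poly_power)
    show "degree ([:1, 1:] ^ ?q :: 'a poly) \<le> ?q"
      using degree_power_le[of "[:1, 1:] :: 'a poly" ?q] by simp
    show "degree (monom 1 ?q + (1 :: 'a poly)) \<le> ?q"
      by (intro degree_add_le) (auto simp: degree_monom_le)
  qed (simp_all add: poly_monom power_card_eq_self)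
  then have "coeff ([:1, 1:] ^ ?q) i = coeff (monom 1 ?q + (1 :: 'a poly)) i"
    by simp
  then show ?thesis
    using assms by (simp add: coeff_linear_poly_power)
qed

lemma of_nat_card_eq_0: "of_nat CARD('a) = (0 :: 'a::{field,finite})"
  using of_nat_card_choose_eq_0[of 1, where 'a = 'a] card_ge_2[where 'a = 'a] by simp

text \<open>The inner binomial coefficients vanish in the field, so q need not be written as a power
  of the characteristic.\<close>

lemma poly_add_power_card:
  fixes x y :: "'a::{field,finite} poly"
  shows "(x + y) ^ CARD('a) = x ^ CARD('a) + y ^ CARD('a)"
proof -
  let ?q = "CARD('a)"
  have q: "?q > 0" by simp
  have "(x + y) ^ ?q = (\<Sum>k\<le>?q. of_nat (?q choose k) * x ^ k * y ^ (?q - k))"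
    by (rule binomial_ring)
  also have "\<dots> = (\<Sum>k\<in>{0, ?q}. of_nat (?q choose k) * x ^ k * y ^ (?q - k))"
    by (rule sum.mono_neutral_right) (auto simp: of_nat_poly of_nat_card_choose_eq_0)
  also have "\<dots> = x ^ ?q + y ^ ?q"
    using q by simp
  finally show ?thesis .
qed

lemma poly_diff_power_card:
  fixes x y :: "'a::{field,finite} poly"
  shows "(x - y) ^ CARD('a) = x ^ CARD('a) - y ^ CARD('a)"
  using poly_add_power_card[of "x - y" y] by simp

text \<open>Homogeneous form of the factorization of X^q - X. For \<open>y \<noteq> 0\<close>, both
  sides are monic of degree q as polynomials in \<open>x\<close> over the polynomial ring, and both
  vanish at the q multiples of \<open>y\<close>.\<close>

lemma prod_diff_smult:
  fixes x y :: "'a::{field,finite} poly"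
  shows "(\<Prod>c\<in>UNIV. x - smult c y) = x ^ CARD('a) - y ^ (CARD('a) - 1) * x"
proof (cases "y = 0")
  case True
  then show ?thesis using card_ge_2[where 'a = 'a] by simp
next
  case False
  let ?q = "CARD('a)"
  let ?p = "\<Prod>c\<in>UNIV. [:- smult c y, 1:]"
  let ?r = "monom 1 ?q - monom (y ^ (?q - 1)) 1"
  have q: "?q \<ge> 2" "?q = Suc (?q - 1)" using card_ge_2[where 'a = 'a] by auto
  have deg: "degree ?p = ?q"
    by (subst degree_prod_eq_sum_degree) auto
  have "?p = ?r"
  proof (rule poly_eqI_degree_lead_coeff[where n = ?q and A = "range (\<lambda>c. smult c y)"])
    have "lead_coeff ?p = 1" by (simp add: lead_coeff_prod)
    then show "coeff ?p ?q = coeff ?r ?q" using deg q by simp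
    have "inj (\<lambda>c. smult c y)"
      using False by (intro injI) (metis eq_iff_diff_eq_0 smult_diff_left smult_eq_0_iff)
    then show "?q \<le> card (range (\<lambda>c. smult c y))" by (simp add: card_image)
    show "degree ?r \<le> ?q"
      using q by (intro degree_diff_le order.trans[OF degree_monom_le]) auto
    show "poly ?p z = poly ?r z" if z: "z \<in> range (\<lambda>c. smult c y)" for z
    proof -
      from z obtain c where c: "z = smult c y" by auto
      have "poly ?p z = 0" unfolding poly_prod using c by (intro prod_zero) auto
      moreover have "y ^ (?q - 1) * z = z ^ ?q"
        unfolding c smult_power power_card_eq_self using q(2)
        by (metis mult.commute mult_smult_right power_Suc)
      ultimately show ?thesis by (simp add: poly_monom)
    qed
  qed (use deg in simp)
  then have "poly ?p x = poly ?r x" by simp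
  then show ?thesis by (simp add: poly_prod poly_monom)
qed

section \<open>Values of psi: additivity, recursion and divisibility by F\<close>

abbreviation polys_below :: "nat \<Rightarrow> 'a::zero poly set" where
  "polys_below m \<equiv> {f. f = 0 \<or> degree f < m}"

lemma power_minus_monic_below:
  fixes p :: "'a::field poly"
  assumes "lead_coeff p = 1"
  shows "[:0, 1:] ^ degree p - p \<in> polys_below (degree p)"
proof -
  let ?f = "[:0, 1:] ^ degree p - p"
  have eq: "[:0, 1:] ^ n = (monom 1 n :: 'a poly)" for n
    by (simp add: monom_altdef)
  have "degree ?f \<le> degree p"
    by (intro degree_diff_le) (auto simp: eq degree_monom_le)
  moreover have "coeff ?f (degree p) = 0"
    using assms by (simp add: eq)
  ultimately show ?thesis
    by (metis (mono_tags, lifting) leading_coeff_0_iff mem_Collect_eq order_le_less)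
qed

text \<open>Splitting off the coefficient of t^m turns the product defining psi of index m+1 into a
  product of translates of psi of index m.\<close>

lemma polys_below_Suc:
  "bij_betw (\<lambda>(c, f). smult c ([:0, 1:] ^ m) + f)
     (UNIV \<times> polys_below m) (polys_below (Suc m) :: 'a::field poly set)"
proof (rule bij_betwI[where g = "\<lambda>g. (coeff g m, g - smult (coeff g m) ([:0, 1:] ^ m))"])
  have eq: "smult c ([:0, 1:] ^ m) = (monom c m :: 'a poly)" for c
    by (simp add: monom_altdef)
  have coeff0: "coeff f m = 0" if "f \<in> polys_below m" for f :: "'a poly"
    using that by (auto simp: coeff_eq_0)
  show "(\<lambda>(c, f). smult c ([:0, 1:] ^ m) + f) \<in> UNIV \<times> polys_below m \<rightarrow> (polys_below (Suc m) :: 'a poly set)"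
    unfolding eq
    by (auto simp: less_Suc_eq_le intro!: degree_add_le degree_monom_le)
  show "(\<lambda>g. (coeff g m, g - smult (coeff g m) ([:0, 1:] ^ m)))
    \<in> polys_below (Suc m) \<rightarrow> UNIV \<times> (polys_below m :: 'a poly set)"
  proof (clarsimp simp only: eq Pi_iff mem_Times_iff fst_conv snd_conv UNIV_I mem_Collect_eq simp_thms)
    fix g :: "'a poly" assume g: "g = 0 \<or> degree g < Suc m"
    let ?f = "g - monom (coeff g m) m"
    assume nz: "\<not> degree ?f < m"
    have "degree ?f \<le> m"
      using g by (intro degree_diff_le) (auto simp: degree_monom_le)
    with nz have "degree ?f = m" by simp
    moreover have "coeff ?f m = 0" by simp
    ultimately show "?f = 0" by (metis leading_coeff_0_iff)
  qed
  show "(\<lambda>g. (coeff g m, g - smult (coeff g m) ([:0, 1:] ^ m))) ((\<lambda>(c, f). smult c ([:0, 1:] ^ m) + f) x) = x"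
    if "x \<in> UNIV \<times> polys_below m" for x :: "'a \<times> 'a poly"
    using that coeff0 by (cases x) (auto simp: eq)
qed auto

text \<open>The values of \<open>carlitz_psi m\<close> at polynomials, kept inside the polynomial
  ring so that divisibility can be used there.\<close>

definition psi_val :: "nat \<Rightarrow> 'a::{field,finite} poly \<Rightarrow> 'a poly" where
  "psi_val m a = (\<Prod>f\<in>polys_below m. a - f)"

lemma psi_val_eq_0_iff: "psi_val m a = 0 \<longleftrightarrow> a \<in> polys_below m"
  unfolding psi_val_def using finite_carlitz_psi_index[of m, where 'a = 'a]
  by (subst prod_zero_iff) auto

lemma psi_val_0 [simp]: "psi_val 0 a = a"
  by (simp add: psi_val_def)

lemma psi_val_Suc_prod:
  "psi_val (Suc m) a = (\<Prod>c\<in>UNIV. psi_val m (a - smult c ([:0, 1:] ^ m)))"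
proof -
  have "psi_val (Suc m) a = (\<Prod>x\<in>UNIV \<times> polys_below m. a - (case x of (c, f) \<Rightarrow> smult c ([:0, 1:] ^ m) + f))"
    unfolding psi_val_def
    by (rule prod.reindex_bij_betw[OF polys_below_Suc, symmetric])
  also have "\<dots> = (\<Prod>c\<in>UNIV. psi_val m (a - smult c ([:0, 1:] ^ m)))"
    unfolding psi_val_def prod.cartesian_product by (intro prod.cong) auto
  finally show ?thesis .
qed

text \<open>Linearity and recursion support each other: linearity at \<open>m\<close> brings
  \<open>psi_val_Suc_prod\<close> into the shape of \<open>prod_diff_smult\<close>, which yields the
  recursion; the recursion passes linearity on to \<open>Suc m\<close>, because the q-th power map
  is additive and fixes the constants.\<close>

lemma psi_val_linear:
  fixes a b :: "'a::{field,finite} poly"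
  shows "psi_val m (a + b) = psi_val m a + psi_val m b"
    and "psi_val m (smult c a) = smult c (psi_val m a)"
    and "psi_val (Suc m) a =
      psi_val m a ^ CARD('a) - psi_val m ([:0, 1:] ^ m) ^ (CARD('a) - 1) * psi_val m a"
proof -
  have step: "psi_val (Suc m) a =
      psi_val m a ^ CARD('a) - psi_val m ([:0, 1:] ^ m) ^ (CARD('a) - 1) * psi_val m a"
    if add: "\<And>a b :: 'a poly. psi_val m (a + b) = psi_val m a + psi_val m b"
      and smult: "\<And>c a :: 'a poly. psi_val m (smult c a) = smult c (psi_val m a)"
    for m and a :: "'a poly"
  proof -
    have "psi_val m (a - smult c ([:0, 1:] ^ m)) = psi_val m a - smult c (psi_val m ([:0, 1:] ^ m))" for c
      using add[of a "smult (- c) ([:0, 1:] ^ m)"] by (simp only: smult) simp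
    then show ?thesis
      by (simp add: psi_val_Suc_prod prod_diff_smult)
  qed
  have lin: "(\<forall>a b :: 'a poly. psi_val m (a + b) = psi_val m a + psi_val m b) \<and>
      (\<forall>c (a :: 'a poly). psi_val m (smult c a) = smult c (psi_val m a))" for m
  proof (induction m)
    case (Suc m)
    then show ?case
      by (auto simp: step poly_add_power_card smult_power power_card_eq_self
          algebra_simps smult_diff_right)
  qed auto
  show "psi_val m (a + b) = psi_val m a + psi_val m b"
    "psi_val m (smult c a) = smult c (psi_val m a)" using lin by auto
  show "psi_val (Suc m) a =
      psi_val m a ^ CARD('a) - psi_val m ([:0, 1:] ^ m) ^ (CARD('a) - 1) * psi_val m a"
    by (rule step) (use lin in auto)
qed

text \<open>The Carlitz bracket [m]; for m > 0 it is the product of the monic irreducible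
  polynomials whose degree divides m.\<close>

definition bracket :: "nat \<Rightarrow> 'a::{field,finite} poly" where
  "bracket m = [:0, 1:] ^ (CARD('a) ^ m) - [:0, 1:]"

lemma bracket_power_card:
  "(bracket m :: 'a poly) ^ CARD('a) = [:0, 1:] ^ (CARD('a) ^ Suc m) - [:0, 1:] ^ CARD('a::{field,finite})"
  unfolding bracket_def poly_diff_power_card by (simp add: power_mult[symmetric] mult.commute)

text \<open>Carlitz's functional equation for multiplication by t, by induction on \<open>m\<close>
  through the recursion in \<open>psi_val_linear(3)\<close>. The second claim is the case a = t^m,
  where psi of index m+1 vanishes.\<close>

lemma psi_val_Suc_mult_t:
  fixes a :: "'a::{field,finite} poly"
  shows "psi_val (Suc m) ([:0, 1:] * a) =
    [:0, 1:] * psi_val (Suc m) a + bracket (Suc m) * psi_val m a ^ CARD('a)"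
    and "psi_val (Suc m) ([:0, 1 :: 'a:] ^ Suc m) =
      bracket (Suc m) * psi_val m ([:0, 1:] ^ m) ^ CARD('a)"
proof -
  let ?q = "CARD('a)" and ?t = "[:0, 1 :: 'a:]"
  \<comment> \<open>Stated conditionally, so that inside the induction it can be applied to the
    induction hypothesis.\<close>
  have top: "psi_val (Suc m) (?t ^ Suc m) = bracket (Suc m) * psi_val m (?t ^ m) ^ ?q"
    if "\<And>a. psi_val (Suc m) (?t * a) = ?t * psi_val (Suc m) a + bracket (Suc m) * psi_val m a ^ ?q"
    for m
  proof -
    have "psi_val (Suc m) (?t ^ m) = 0"
      unfolding psi_val_eq_0_iff by (simp add: degree_power_eq)
    with that[of "?t ^ m"] show ?thesis by simp
  qed
  have main: "psi_val (Suc m) (?t * a) = ?t * psi_val (Suc m) a + bracket (Suc m) * psi_val m a ^ ?q"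
    for m and a :: "'a poly"
  proof (induction m arbitrary: a)
    case 0
    \<comment> \<open>The recursion at index 0 has coefficient \<open>1 ^ (q - 1)\<close>, since
      \<open>psi_val 0\<close> is the identity and t^0 = 1.\<close>
    have "(t * a) ^ ?q - 1 ^ (?q - 1) * (t * a) = t * (a ^ ?q - 1 ^ (?q - 1) * a) + (t ^ ?q - t) * a ^ ?q"
      for t :: "'a poly"
      by (simp add: algebra_simps power_mult_distrib)
    then show ?case
      by (simp only: psi_val_linear(3) psi_val_0 power_0 bracket_def power_Suc mult_1_right)
  next
    case (Suc m)
    define M where "M = psi_val m (?t ^ m)"
    define N where "N = psi_val (Suc m) (?t ^ Suc m)"
    define B where "B = (bracket (Suc m) :: 'a poly)"
    define u where "u = psi_val m a"
    define v where "v = psi_val (Suc m) a"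
    have N: "N = B * M ^ ?q"
      unfolding N_def M_def B_def using top[OF Suc.IH] .
    have v: "v = u ^ ?q - M ^ (?q - 1) * u"
      unfolding u_def v_def M_def by (rule psi_val_linear(3))
    have vq: "v ^ ?q = (u ^ ?q) ^ ?q - (M ^ ?q) ^ (?q - 1) * u ^ ?q"
      unfolding v poly_diff_power_card by (simp add: power_mult_distrib power_mult[symmetric] mult.commute)
    \<comment> \<open>In bracket notation: [m+2] = [m+1]^q + [1].\<close>
    have BB: "bracket (Suc (Suc m)) = B ^ ?q + (?t ^ ?q - ?t)"
      unfolding B_def bracket_power_card by (simp add: bracket_def)
    \<comment> \<open>Together with \<open>vq\<close> this collapses the terms in \<open>u\<close>
      to \<open>B ^ q * v ^ q\<close>.\<close>
    have Nq: "N ^ (?q - 1) * B = B ^ ?q * (M ^ ?q) ^ (?q - 1)"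
      unfolding N power_mult_distrib power_minus_mult[OF zero_less_card_finite, of B, symmetric]
      by (simp only: ac_simps)
    have tv: "psi_val (Suc m) (?t * a) = ?t * v + B * u ^ ?q"
      using Suc.IH by (simp add: u_def v_def B_def)
    have rec: "psi_val (Suc (Suc m)) b = psi_val (Suc m) b ^ ?q - N ^ (?q - 1) * psi_val (Suc m) b" for b
      unfolding N_def by (rule psi_val_linear(3))
    have "psi_val (Suc (Suc m)) (?t * a)
        = (?t * v + B * u ^ ?q) ^ ?q - N ^ (?q - 1) * (?t * v + B * u ^ ?q)"
      unfolding rec tv ..
    also have "\<dots> = ?t ^ ?q * v ^ ?q + B ^ ?q * (u ^ ?q) ^ ?q - ?t * (N ^ (?q - 1) * v)
        - (N ^ (?q - 1) * B) * u ^ ?q"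
      unfolding poly_add_power_card power_mult_distrib by (simp add: ring_distribs ac_simps)
    also have "\<dots> = ?t ^ ?q * v ^ ?q + B ^ ?q * v ^ ?q - ?t * (N ^ (?q - 1) * v)"
      unfolding Nq vq by (simp add: ring_distribs ac_simps)
    also have "\<dots> = ?t * (v ^ ?q - N ^ (?q - 1) * v) + bracket (Suc (Suc m)) * v ^ ?q"
      unfolding BB by (simp add: ring_distribs ac_simps)
    finally show ?case unfolding rec v_def .
  qed
  show "psi_val (Suc m) (?t * a) = ?t * psi_val (Suc m) a + bracket (Suc m) * psi_val m a ^ ?q"
    by (rule main)
  show "psi_val (Suc m) (?t ^ Suc m) = bracket (Suc m) * psi_val m (?t ^ m) ^ ?q"
    by (rule top[OF main])
qed

lemma carlitz_F_0 [simp]: "carlitz_F 0 = 1"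
  by (simp add: carlitz_F_def)

lemma carlitz_F_Suc:
  "(carlitz_F (Suc m) :: 'a::{field,finite} poly) = bracket (Suc m) * carlitz_F m ^ CARD('a)"
  unfolding carlitz_F_def prod.lessThan_Suc_shift
  by (simp add: bracket_def prod_power_distrib power_mult[symmetric] mult.commute)

text \<open>As \<open>f\<close> runs through the polynomials of degree below m, t^m - f runs through
  the monic ones of degree m, so \<open>carlitz_F m\<close> is their product. Both sides obey the
  same recursion.\<close>

lemma psi_val_power_t: "psi_val m ([:0, 1:] ^ m) = carlitz_F m"
  by (induction m) (simp, simp only: psi_val_Suc_mult_t(2) carlitz_F_Suc)

text \<open>By additivity: \<open>a\<close> differs from the power of t of the same degree by a zero
  of psi.\<close>

lemma psi_val_monic:
  assumes "lead_coeff a = 1"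
  shows "psi_val (degree a) a = carlitz_F (degree a)"
proof -
  let ?f = "[:0, 1:] ^ degree a - a"
  have "psi_val (degree a) ?f = 0"
    unfolding psi_val_eq_0_iff by (rule power_minus_monic_below[OF assms])
  with psi_val_linear(1)[of "degree a" a ?f] show ?thesis
    by (simp add: psi_val_power_t)
qed

lemma carlitz_F_nonzero: "carlitz_F m \<noteq> 0"
  unfolding psi_val_power_t[symmetric] psi_val_eq_0_iff by (simp add: degree_power_eq)

text \<open>Induction on \<open>m\<close>, and inside it on \<open>a\<close>. The constant
  coefficient is a zero of psi of index m+1 and drops out; the rest is a multiple of t, where the
  functional equation adds a term divisible by [m+1] F_m^q = F_(m+1).\<close>

lemma carlitz_F_dvd_psi_val: "carlitz_F m dvd psi_val m a"
proof (induction m arbitrary: a)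
  case (Suc m)
  show ?case
  proof (induction a)
    case 0
    have "psi_val (Suc m) (0 :: 'a poly) = 0" by (simp only: psi_val_eq_0_iff) simp
    then show ?case by simp
  next
    case (pCons c a)
    have "psi_val (Suc m) [:c:] = 0"
      unfolding psi_val_eq_0_iff by simp
    moreover have "pCons c a = [:c:] + [:0, 1:] * a" by simp
    ultimately have "psi_val (Suc m) (pCons c a) = psi_val (Suc m) ([:0, 1:] * a)"
      by (simp only: psi_val_linear(1) add_0_left)
    also have "carlitz_F (Suc m) dvd \<dots>"
      unfolding psi_val_Suc_mult_t(1)
      unfolding carlitz_F_Suc
      by (intro dvd_add[OF dvd_mult] pCons.IH[unfolded carlitz_F_Suc]
          mult_dvd_mono dvd_refl dvd_power_same Suc.IH)
    finally show ?case .
  qed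
qed simp

section \<open>Irreducible polynomials of every positive degree\<close>

lemma degree_irreducible_pos:
  fixes p :: "'a::field poly"
  shows "irreducible p \<Longrightarrow> degree p > 0"
  using is_unit_iff_degree[of p] irreducible_not_unit[of p] by fastforce

lemma ex_irreducible_factor:
  fixes p :: "'a::field poly"
  assumes "degree p > 0"
  shows "\<exists>r. irreducible r \<and> r dvd p"
  using assms
proof (induction "degree p" arbitrary: p rule: less_induct)
  case less
  show ?case
  proof (cases "irreducible p")
    case False
    have "p \<noteq> 0" "\<not> p dvd 1" using less.prems by (auto simp: is_unit_poly_iff)
    with False obtain a b where ab: "p = a * b" "\<not> a dvd 1" "\<not> b dvd 1"
      by (auto simp: Factorial_Ring.irreducible_def)
    with \<open>p \<noteq> 0\<close> have "degree a > 0" "degree a < degree p"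
      by (auto simp: is_unit_iff_degree degree_mult_eq)
    with less.hyps show ?thesis unfolding ab(1) by (meson dvd_mult2)
  qed auto
qed

text \<open>Strip one irreducible factor \<open>x\<close> off \<open>p\<close>. Squarefreeness keeps
  \<open>x\<close> from dividing the cofactor \<open>p'\<close>, so in \<open>r = p' * r'\<close> it
  must divide \<open>r'\<close>.\<close>

lemma squarefree_dvdI:
  fixes p r :: "'a::field poly"
  assumes "p \<noteq> 0"
    and "\<And>x. irreducible x \<Longrightarrow> x dvd p \<Longrightarrow> \<not> x\<^sup>2 dvd p"
    and "\<And>x. irreducible x \<Longrightarrow> x dvd p \<Longrightarrow> x dvd r"
  shows "p dvd r"
  using assms
proof (induction "degree p" arbitrary: p rule: less_induct)
  case less
  show ?case
  proof (cases "degree p = 0")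
    case True
    with less.prems(1) have "p dvd 1" by (simp add: is_unit_iff_degree)
    then show ?thesis by (rule unit_imp_dvd)
  next
    case False
    then obtain x where x: "irreducible x" "x dvd p"
      using ex_irreducible_factor by blast
    then obtain p' where p': "p = x * p'" by blast
    have nz: "p' \<noteq> 0" "x \<noteq> 0" using p' less.prems(1) by auto
    have "degree x > 0" using x(1) by (rule degree_irreducible_pos)
    then have "degree p' < degree p" using nz by (simp add: p' degree_mult_eq)
    then have "p' dvd r"
    proof (rule less.hyps)
      have "p' dvd p" by (simp add: p')
      then show "\<not> y\<^sup>2 dvd p'" "y dvd r" if "irreducible y" "y dvd p'" for y
        using less.prems(2,3)[of y] that by (blast intro: dvd_trans)+
    qed (rule nz(1))
    then obtain r' where r': "r = p' * r'" by blast
    have "\<not> x dvd p'"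
      using less.prems(2)[OF x] unfolding p' power2_eq_square by (simp add: nz(2))
    moreover have "x dvd p' * r'" using less.prems(3)[OF x] r' by simp
    ultimately have "x dvd r'"
      using field_poly_irreducible_imp_prime[OF x(1)] by (auto simp: prime_elem_dvd_mult_iff)
    then show ?thesis unfolding p' r' by (metis mult.commute mult_dvd_mono dvd_refl)
  qed
qed

lemma prime_elem_dvd_prodD:
  assumes "prime_elem p" "finite A" "p dvd prod f A"
  shows "\<exists>x\<in>A. p dvd f x"
  using assms(2,3)
  by (induction A rule: finite_induct)
    (use assms(1) in \<open>auto simp: prime_elem_dvd_mult_iff prime_elem_not_unit\<close>)

text \<open>A prime dividing the product of the monic polynomials of degree \<open>m\<close> divides
  one of them.\<close>

lemma prime_elem_dvd_carlitz_FD: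
  assumes "prime_elem p" "p dvd carlitz_F m"
  shows "degree p \<le> m"
proof -
  from assms have "p dvd (\<Prod>f\<in>polys_below m. [:0, 1:] ^ m - f)"
    by (simp add: psi_val_power_t[symmetric] psi_val_def)
  then obtain f where f: "f \<in> polys_below m" "p dvd [:0, 1:] ^ m - f"
    using prime_elem_dvd_prodD[OF assms(1) finite_carlitz_psi_index] by blast
  have "[:0, 1:] ^ m \<noteq> f" using f(1) by (auto simp: degree_power_eq)
  then have "degree p \<le> degree ([:0, 1:] ^ m - f)"
    using f(2) by (intro dvd_imp_degree_le) auto
  also have "\<dots> \<le> m" using f(1) by (intro degree_diff_le) (auto simp: degree_power_eq)
  finally show ?thesis .
qed

text \<open>The monic associate of \<open>p\<close>, of degree d+1, is one of the factors of F_(d+1)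
  = [d+1] F_d^q, and \<open>p\<close> has too large a degree to divide F_d.\<close>

lemma irreducible_dvd_bracket:
  fixes p :: "'a::{field,finite} poly"
  assumes "irreducible p"
  shows "p dvd bracket (degree p)"
proof -
  define r where "r = smult (inverse (lead_coeff p)) p"
  have p: "prime_elem p" "p \<noteq> 0" "degree p > 0"
    using field_poly_irreducible_imp_prime[OF assms] degree_irreducible_pos[OF assms] by auto
  have r: "lead_coeff r = 1" "degree r = degree p" "p dvd r"
    using p by (auto simp: r_def dvd_smult)
  obtain d where d: "degree p = Suc d" using p(3) by (cases "degree p") auto
  have "[:0, 1:] ^ degree p - r \<in> polys_below (degree p)"
    using power_minus_monic_below[OF r(1)] unfolding r(2) .
  then have "r dvd psi_val (degree p) ([:0, 1:] ^ degree p)"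
    unfolding psi_val_def by (rule dvd_prod_eqI[OF finite_carlitz_psi_index]) simp
  with r(3) have "p dvd bracket (Suc d) * carlitz_F d ^ CARD('a)"
    unfolding psi_val_power_t d carlitz_F_Suc by (rule dvd_trans)
  moreover have "\<not> p dvd carlitz_F d ^ CARD('a)"
  proof
    assume "p dvd carlitz_F d ^ CARD('a)"
    then have "p dvd carlitz_F d" by (rule prime_elem_dvd_power[OF p(1)])
    then show False using prime_elem_dvd_carlitz_FD[OF p(1), of d] d by simp
  qed
  ultimately show ?thesis
    using p(1) d by (simp add: prime_elem_dvd_mult_iff)
qed

lemma degree_bracket:
  assumes "m > 0"
  shows "degree (bracket m :: 'a::{field,finite} poly) = CARD('a) ^ m"
proof -
  have "CARD('a) ^ m > 1"
    using card_ge_2[where 'a = 'a] assms by (intro one_less_power) auto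
  then have "degree (- [:0, 1 :: 'a:]) < degree ([:0, 1 :: 'a:] ^ (CARD('a) ^ m))"
    by (simp add: degree_power_eq)
  from degree_add_eq_left[OF this] show ?thesis
    by (simp add: bracket_def degree_power_eq del: minus_pCons)
qed

text \<open>The derivative of the bracket is -1, because q vanishes in the field, and a repeated
  factor divides the derivative.\<close>

lemma bracket_squarefree:
  fixes x :: "'a::{field,finite} poly"
  assumes "m > 0" "x\<^sup>2 dvd bracket m"
  shows "x dvd 1"
proof -
  obtain y where "bracket m = x\<^sup>2 * y" using assms(2) by (rule dvdE)
  then have y: "bracket m = x * (x * y)" by (simp add: power2_eq_square mult.assoc)
  have "of_nat (CARD('a) ^ m) = (0 :: 'a)"
    using assms(1) by (simp add: of_nat_card_eq_0)
  then have "pderiv (bracket m :: 'a poly) = - 1"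
    by (simp only: bracket_def pderiv_diff pderiv_power) (simp add: pderiv_pCons one_pCons)
  moreover have "x dvd pderiv (bracket m)"
    unfolding y pderiv_mult by (intro dvd_add) auto
  ultimately show ?thesis by simp
qed

text \<open>
  Otherwise the squarefree polynomial $t^{q^s} - t$ would divide the product of the
  $t^{q^d} - t$ with $0 < d < s$, whose degree is too small.
\<close>
lemma ex_monic_irreducible:
  assumes "s > 0"
  shows "\<exists>p :: 'a::{field,finite} poly. irreducible p \<and> lead_coeff p = 1 \<and> degree p = s"
proof -
  let ?q = "CARD('a)"
  have "\<exists>p :: 'a poly. irreducible p \<and> degree p = s"
  proof (rule ccontr)
    assume none: "\<nexists>p :: 'a poly. irreducible p \<and> degree p = s"
    let ?r = "\<Prod>d\<in>{1..<s}. bracket d :: 'a poly"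
    have nz: "bracket d \<noteq> (0 :: 'a poly)" if "d > 0" for d
      using degree_bracket[OF that, where 'a = 'a] by auto
    have "bracket s dvd ?r"
    proof (rule squarefree_dvdI)
      show "bracket s \<noteq> (0 :: 'a poly)" by (rule nz[OF assms])
    next
      fix x :: "'a poly" assume x: "irreducible x" "x dvd bracket s"
      then show "\<not> x\<^sup>2 dvd bracket s"
        using bracket_squarefree[OF assms, of x] by (auto dest: irreducible_not_unit)
      \<comment> \<open>The bracket is a factor of F_s, which bounds the degree of \<open>x\<close>
        by \<open>s\<close>; equality is excluded by \<open>none\<close>.\<close>
      have "x dvd carlitz_F s"
        using x(2) assms by (cases s) (auto simp: carlitz_F_Suc)
      then have "degree x \<le> s"
        by (rule prime_elem_dvd_carlitz_FD[OF field_poly_irreducible_imp_prime[OF x(1)]])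
      moreover have "degree x \<noteq> s" using none x(1) by blast
      moreover have "degree x > 0" using x(1) by (rule degree_irreducible_pos)
      ultimately have "bracket (degree x) dvd ?r"
        by (intro dvd_prodI) auto
      then show "x dvd ?r" using irreducible_dvd_bracket[OF x(1)] by (rule dvd_trans[rotated])
    qed
    then have "?q ^ s \<le> degree ?r"
      using nz by (subst degree_bracket[OF assms, symmetric], intro dvd_imp_degree_le) auto
    also have "degree ?r = (\<Sum>d\<in>{1..<s}. ?q ^ d)"
      using nz by (subst degree_prod_eq_sum_degree) (auto simp: degree_bracket)
    \<comment> \<open>From s to s+1 the sum gains at most q^s, while the bound at least
      doubles.\<close>
    also have "\<dots> < ?q ^ s"
    proof (induction s)
      case (Suc s)
      have "?q ^ s + ?q ^ s \<le> ?q ^ Suc s"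
        using mult_le_mono1[OF card_ge_2[where 'a = 'a], of "?q ^ s"] by (simp only: power_Suc)
      moreover have "(\<Sum>d\<in>{1..<Suc s}. ?q ^ d) \<le> (\<Sum>d\<in>{1..<s}. ?q ^ d) + ?q ^ s"
        by (cases s) auto
      ultimately show ?case using Suc.IH by linarith
    qed simp
    finally show False by simp
  qed
  then obtain p :: "'a poly" where p: "irreducible p" "degree p = s" by blast
  then have "p \<noteq> 0" by auto
  let ?c = "[:inverse (lead_coeff p):]"
  have "?c dvd 1" using \<open>p \<noteq> 0\<close> by (simp add: is_unit_iff_degree)
  then have "irreducible (?c * p)" using p(1) by (simp only: irreducible_mult_unit_left)
  with p(2) \<open>p \<noteq> 0\<close> show ?thesis by (intro exI[of _ "?c * p"]) auto
qed

section \<open>Factors of powers in the ring of integer-valued polynomials\<close>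

lemma int_valued_ringD:
  "p \<in> carrier int_valued_ring \<Longrightarrow> \<exists>c. poly p (to_fract a) = to_fract c"
  by (auto simp: int_valued_ring_def)

lemma to_fract_prod: "to_fract (prod f A) = (\<Prod>x\<in>A. to_fract (f x))"
  by (induction A rule: infinite_finite_induct) simp_all

lemma to_fract_prod_mset: "to_fract (\<Prod>x\<in>#A. f x) = (\<Prod>x\<in>#A. to_fract (f x))"
  by (induction A) simp_all

lemma to_fract_power: "to_fract (a ^ n) = to_fract a ^ n"
  by (induction n) simp_all

lemma poly_carlitz_psi: "poly (carlitz_psi m) (to_fract a) = to_fract (psi_val m a)"
  by (simp add: carlitz_psi_def psi_val_def poly_prod to_fract_prod)

lemma degree_carlitz_psi:
  "degree (carlitz_psi m :: 'a::{field,finite} poly fract poly) = CARD('a) ^ m"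
proof -
  have card: "card (polys_below m :: 'a poly set) = CARD('a) ^ m"
  proof (induction m)
    case (Suc m)
    then show ?case
      using bij_betw_same_card[OF polys_below_Suc[of m, where 'a = 'a]]
      by (simp add: card_cartesian_product)
  qed simp
  have "degree (carlitz_psi m :: 'a poly fract poly) = card (polys_below m :: 'a poly set)"
    unfolding carlitz_psi_def by (subst degree_prod_eq_sum_degree) auto
  with card show ?thesis by simp
qed

text \<open>The binomial polynomial of index q^s without reference to digits;
  \<open>carlitz_binomial_power_card\<close> identifies the two.\<close>

definition carlitz_basis :: "nat \<Rightarrow> 'a::{field,finite} poly fract poly" where
  "carlitz_basis s = smult (inverse (to_fract (carlitz_F s))) (carlitz_psi s)"

lemma degree_carlitz_basis:
  "degree (carlitz_basis s :: 'a::{field,finite} poly fract poly) = CARD('a) ^ s"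
  by (simp add: carlitz_basis_def degree_carlitz_psi carlitz_F_nonzero)

lemma carlitz_basis_nonzero: "carlitz_basis s \<noteq> 0"
  using degree_carlitz_basis[of s, where 'a = 'a] by auto

lemma carlitz_basis_in_carrier: "carlitz_basis s \<in> carrier int_valued_ring"
proof -
  have "poly (carlitz_basis s) (to_fract a) \<in> range to_fract" for a :: "'a poly"
  proof -
    obtain c where "psi_val s a = carlitz_F s * c"
      using carlitz_F_dvd_psi_val by blast
    then have "poly (carlitz_basis s) (to_fract a) = to_fract c"
      by (simp add: carlitz_basis_def poly_carlitz_psi carlitz_F_nonzero field_simps)
    then show ?thesis by blast
  qed
  then show ?thesis by (simp add: int_valued_ring_def)
qed

lemma poly_carlitz_basis_monic:
  assumes "lead_coeff a = 1" "degree a = s"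
  shows "poly (carlitz_basis s) (to_fract a) = 1"
  using psi_val_monic[OF assms(1)] assms(2)
  by (simp add: carlitz_basis_def poly_carlitz_psi carlitz_F_nonzero)

section \<open>The factors of a power of \<open>carlitz_basis s\<close>\<close>

lemma factor_of_prod_linear:
  fixes \<phi> :: "'b \<Rightarrow> 'c::field"
  assumes "g * h = smult c (\<Prod>x\<in>#A. [:- \<phi> x, 1:])" "c \<noteq> 0"
  shows "\<exists>B d. B \<subseteq># A \<and> g = smult d (\<Prod>x\<in>#B. [:- \<phi> x, 1:])"
  using assms(1)
proof (induction A arbitrary: g h)
  case empty
  then have gh: "g * h = [:c:]" by simp
  then have "g \<noteq> 0" "h \<noteq> 0" using assms(2) by auto
  with arg_cong[OF gh, of degree] have "degree g = 0" by (simp add: degree_mult_eq)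
  then obtain d where "g = [:d:]" by (rule degree_eq_zeroE)
  then show ?case by (intro exI[of _ "{#}"] exI[of _ d]) simp
next
  case (add x A)
  let ?l = "[:- \<phi> x, 1:]"
  have gh: "g * h = ?l * smult c (\<Prod>x\<in>#A. [:- \<phi> x, 1:])"
    using add.prems by (simp only: image_mset_add_mset prod_mset.add_mset mult_smult_right)
  \<comment> \<open>The linear factor is prime, so it divides \<open>g\<close> or \<open>h\<close>
    and cancels there; \<open>B\<close> collects the indices that go to \<open>g\<close>.\<close>
  then have "?l dvd g * h" by (metis dvd_triv_left)
  then consider "?l dvd g" | "?l dvd h"
    using prime_elem_linear_field_poly[of 1 "- \<phi> x"] by (auto simp: prime_elem_dvd_mult_iff)
  then show ?case
  proof cases
    case 1
    then obtain g' where g': "g = ?l * g'" by blast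
    from gh have "?l * (g' * h) = ?l * smult c (\<Prod>x\<in>#A. [:- \<phi> x, 1:])"
      unfolding g' by (simp only: mult.assoc)
    then have "g' * h = smult c (\<Prod>x\<in>#A. [:- \<phi> x, 1:])"
      by (rule mult_left_cancel[THEN iffD1, rotated]) simp
    from add.IH[OF this] obtain B d
      where "B \<subseteq># A" "g' = smult d (\<Prod>x\<in>#B. [:- \<phi> x, 1:])" by blast
    then show ?thesis
      unfolding g' by (intro exI[of _ "add_mset x B"] exI[of _ d]) simp
  next
    case 2
    then obtain h' where h': "h = ?l * h'" by blast
    from gh have "?l * (g * h') = ?l * smult c (\<Prod>x\<in>#A. [:- \<phi> x, 1:])"
      unfolding h' by (simp only: mult.left_commute)
    then have "g * h' = smult c (\<Prod>x\<in>#A. [:- \<phi> x, 1:])"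
      by (rule mult_left_cancel[THEN iffD1, rotated]) simp
    from add.IH[OF this] obtain B d
      where "B \<subseteq># A" "g = smult d (\<Prod>x\<in>#B. [:- \<phi> x, 1:])" by blast
    then show ?thesis
      by (intro exI[of _ B] exI[of _ d]) (auto intro: subset_mset.trans)
  qed
qed

lemma carlitz_psi_power:
  "carlitz_psi s ^ m = (\<Prod>x\<in>#repeat_mset m (mset_set (polys_below s)). [:- to_fract x, 1:])"
proof (induction m)
  case (Suc m)
  then show ?case
    by (simp add: carlitz_psi_def prod_unfold_prod_mset mult.commute)
qed simp

text \<open>Modulo \<open>p\<close> the factor \<open>p + f - x\<close> is \<open>f - x\<close>,
  whose degree is too small for divisibility unless \<open>x = f\<close>, and then the factor is
  \<open>p\<close> itself. So the exponent of \<open>p\<close> reads off the multiplicity of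
  \<open>f\<close>.\<close>

lemma prime_part_of_shifted_prod:
  fixes p :: "'a::field poly"
  assumes p: "prime_elem p" and f: "f \<in> polys_below (degree p)"
    and "set_mset B \<subseteq> polys_below (degree p)"
  shows "\<exists>r. (\<Prod>x\<in>#B. p + f - x) = p ^ count B f * r \<and> \<not> p dvd r"
  using assms(3)
proof (induction B)
  case empty
  then show ?case using p by (auto simp: prime_elem_def)
next
  case (add x B)
  then obtain r where r: "(\<Prod>x\<in>#B. p + f - x) = p ^ count B f * r" "\<not> p dvd r"
    by auto
  show ?case
  proof (cases "x = f")
    case True
    then show ?thesis using r by (auto simp: ac_simps)
  next
    case False
    have "\<not> p dvd p + f - x"
    proof
      assume "p dvd p + f - x"
      then have "p dvd f - x" by (metis add_diff_eq dvd_add_right_iff dvd_refl)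
      then have "degree p \<le> degree (f - x)" using False by (intro dvd_imp_degree_le) auto
      moreover have "degree (f - x) < degree p"
        using f add.prems False by (auto intro!: degree_diff_less)
      ultimately show False by simp
    qed
    with r(2) p have "\<not> p dvd (p + f - x) * r"
      by (auto simp: prime_elem_dvd_mult_iff)
    then show ?thesis using r False
      by (intro exI[of _ "(p + f - x) * r"]) (auto simp: ac_simps)
  qed
qed

text \<open>Irreducibility and unique factorization both rest on this form of the factors;
  \<open>j\<close> is the common multiplicity of all roots of \<open>g\<close>.\<close>

lemma factor_of_carlitz_basis_power:
  fixes g h :: "'a::{field,finite} poly fract poly"
  assumes gh: "g * h = carlitz_basis s ^ m"
    and g: "g \<in> carrier int_valued_ring" and h: "h \<in> carrier int_valued_ring"
  shows "\<exists>u j. u dvd 1 \<and> g = smult (to_fract u) (carlitz_basis s ^ j)"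
proof -
  let ?S = "polys_below s :: 'a poly set"
  let ?c = "inverse (to_fract (carlitz_F s)) ^ m"
  have fin: "finite ?S" by (rule finite_carlitz_psi_index)
  have "g * h = smult ?c (\<Prod>x\<in>#repeat_mset m (mset_set ?S). [:- to_fract x, 1:])"
    unfolding gh carlitz_basis_def smult_power carlitz_psi_power ..
  moreover have "?c \<noteq> 0" by (simp add: carlitz_F_nonzero)
  ultimately obtain B d where B: "B \<subseteq># repeat_mset m (mset_set ?S)"
      and gB: "g = smult d (\<Prod>x\<in>#B. [:- to_fract x, 1:])"
    using factor_of_prod_linear[of g h ?c to_fract] by blast
  have BS: "set_mset B \<subseteq> ?S"
  proof
    fix x assume "x \<in># B"
    with B have "x \<in># repeat_mset m (mset_set ?S)" by (rule mset_subset_eqD)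
    then have "count (repeat_mset m (mset_set ?S)) x \<noteq> 0" by (simp only: count_eq_zero_iff not_not)
    then have "x \<in># mset_set ?S" unfolding count_repeat_mset by (metis count_inI mult_0_right)
    then show "x \<in> ?S" using fin by simp
  qed
  define N where "N a = (\<Prod>x\<in>#B. a - x)" for a
  \<comment> \<open>The values of \<open>g\<close> and \<open>h\<close> at \<open>a\<close> multiply
    to 1, and the value of \<open>g\<close> is \<open>d * to_fract (N a)\<close>.\<close>
  have unit: "\<exists>u. u dvd 1 \<and> d * to_fract (N a) = to_fract u"
    if a: "lead_coeff a = 1" "degree a = s" for a
  proof -
    obtain u v where uv: "poly g (to_fract a) = to_fract u" "poly h (to_fract a) = to_fract v"
      using int_valued_ringD[OF g, of a] int_valued_ringD[OF h, of a] by blast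
    have "poly g (to_fract a) * poly h (to_fract a) = 1"
      using arg_cong[OF gh, of "\<lambda>p. poly p (to_fract a)"] poly_carlitz_basis_monic[OF a] by simp
    then have "to_fract (u * v) = to_fract 1" unfolding uv by simp
    then have "u dvd 1" unfolding to_fract_eq_iff by (metis dvd_triv_left)
    moreover have "d * to_fract (N a) = to_fract u"
      unfolding uv(1)[symmetric] gB N_def by (simp add: poly_prod_mset to_fract_prod_mset)
    ultimately show ?thesis by blast
  qed
  \<comment> \<open>The scalar \<open>d\<close> is an unknown fraction, so \<open>N a\<close> itself
    need not be a unit; comparing two such values eliminates \<open>d\<close>.\<close>
  have N_dvd: "N a dvd N b"
    if a: "lead_coeff a = 1" "degree a = s" and b: "lead_coeff b = 1" "degree b = s" for a b
  proof -
    obtain u v where u: "u dvd 1" "d * to_fract (N a) = to_fract u"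
        and v: "d * to_fract (N b) = to_fract v"
      using unit[OF a] unit[OF b] by blast
    have "to_fract (N b * u) = to_fract (N a * v)"
      unfolding to_fract_mult u(2)[symmetric] v[symmetric] by simp
    then have "N a dvd N b * u" unfolding to_fract_eq_iff by simp
    then show ?thesis using u(1) by (simp add: dvd_mult_unit_iff)
  qed
  have "\<exists>j. \<forall>f\<in>?S. count B f = j"
  \<comment> \<open>For \<open>s = 0\<close> the only possible root is 0, so there are no
    multiplicities to compare.\<close>
  proof (cases "s = 0")
    case False
    then obtain p :: "'a poly" where p: "irreducible p" "lead_coeff p = 1" "degree p = s"
      using ex_monic_irreducible[of s, where 'a = 'a] by auto
    have prime: "prime_elem p" using p(1) by (rule field_poly_irreducible_imp_prime)
    have monic: "lead_coeff (p + f) = 1 \<and> degree (p + f) = s" if "f \<in> ?S" for f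
      using that p False by (auto simp: degree_add_eq_left coeff_eq_0)
    \<comment> \<open>Since \<open>N (p + f)\<close> divides \<open>N (p + f')\<close>, its exponent
      of \<open>p\<close> cannot be the larger one.\<close>
    have "count B f \<le> count B f'" if f: "f \<in> ?S" "f' \<in> ?S" for f f'
    proof (rule ccontr)
      assume less: "\<not> count B f \<le> count B f'"
      obtain r where r: "N (p + f) = p ^ count B f * r"
        using prime_part_of_shifted_prod[OF prime, of f B] f(1) BS p(3) by (auto simp: N_def)
      obtain r' where r': "N (p + f') = p ^ count B f' * r'" "\<not> p dvd r'"
        using prime_part_of_shifted_prod[OF prime, of f' B] f(2) BS p(3) by (auto simp: N_def)
      have "p ^ Suc (count B f') dvd p ^ count B f"
        using less by (intro le_imp_power_dvd) simp
      also have "\<dots> dvd N (p + f)" by (simp add: r)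
      also have "\<dots> dvd N (p + f')" using monic f by (intro N_dvd) auto
      finally have "p ^ count B f' * p dvd p ^ count B f' * r'" by (simp add: r' mult.commute)
      then show False using r'(2) p(1) by simp
    qed
    then show ?thesis by (meson antisym)
  qed auto
  then obtain j where j: "\<And>f. f \<in> ?S \<Longrightarrow> count B f = j" by blast
  have "(\<Prod>x\<in>#B. [:- to_fract x, 1:]) = (\<Prod>x\<in>?S. [:- to_fract x, 1:] ^ count B x)"
    unfolding image_prod_mset_multiplicity
    by (rule prod.mono_neutral_left) (use fin BS in \<open>auto simp: not_in_iff\<close>)
  also have "\<dots> = carlitz_psi s ^ j"
    by (simp add: j carlitz_psi_def prod_power_distrib)
  finally have g_eq: "g = smult d (carlitz_psi s ^ j)" using gB by simp
  \<comment> \<open>Evaluation at t^s, where psi takes the value F_s, shows that \<open>d\<close> is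
    a unit divided by F_s^j.\<close>
  obtain u where u: "u dvd 1" "d * to_fract (N ([:0, 1:] ^ s)) = to_fract u"
  proof -
    have "lead_coeff ([:0, 1 :: 'a:] ^ s) = 1" "degree ([:0, 1 :: 'a:] ^ s) = s"
      by (simp_all only: lead_coeff_power) (simp_all add: degree_power_eq)
    from unit[OF this] that show thesis by blast
  qed
  have "d * to_fract (N ([:0, 1:] ^ s)) = poly g (to_fract ([:0, 1:] ^ s))"
    unfolding gB N_def by (simp add: poly_prod_mset to_fract_prod_mset)
  also have "\<dots> = d * to_fract (carlitz_F s) ^ j"
    unfolding g_eq by (simp add: poly_carlitz_psi psi_val_power_t)
  finally have "d = to_fract u * inverse (to_fract (carlitz_F s)) ^ j"
    using u(2) carlitz_F_nonzero[of s, where 'a = 'a] by (simp add: field_simps)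
  then have "g = smult (to_fract u) (carlitz_basis s ^ j)"
    unfolding g_eq carlitz_basis_def smult_power by simp
  with u(1) show ?thesis by blast
qed

section \<open>Units, irreducibility and unique factorization in the ring\<close>

lemma int_valued_ring_simps [simp]:
  "mult int_valued_ring = (*)" "one int_valued_ring = 1" "zero int_valued_ring = 0"
  by (simp_all add: int_valued_ring_def)

interpretation int_valued: domain "int_valued_ring :: 'd::idom fract poly ring"
  by (rule domain_int_valued_ring)

lemma mult_in_int_valued:
  "p \<in> carrier int_valued_ring \<Longrightarrow> r \<in> carrier int_valued_ring \<Longrightarrow> p * r \<in> carrier int_valued_ring"
  using int_valued.m_closed by simp

lemma one_in_int_valued: "1 \<in> carrier int_valued_ring"
  using int_valued.one_closed by simp

lemma power_in_int_valued:
  "p \<in> carrier int_valued_ring \<Longrightarrow> p ^ n \<in> carrier int_valued_ring"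
  by (induction n) (auto intro: mult_in_int_valued one_in_int_valued)

lemma prod_in_int_valued:
  "(\<And>i. i \<in> A \<Longrightarrow> f i \<in> carrier int_valued_ring) \<Longrightarrow> prod f A \<in> carrier int_valued_ring"
  by (induction A rule: infinite_finite_induct) (auto intro: mult_in_int_valued one_in_int_valued)

lemma prod_list_in_int_valued:
  "set fs \<subseteq> carrier int_valued_ring \<Longrightarrow> prod_list fs \<in> carrier int_valued_ring"
  by (induction fs) (auto intro: mult_in_int_valued one_in_int_valued)

lemma int_valued_pow: "p [^]\<^bsub>int_valued_ring\<^esub> (n :: nat) = p ^ n"
  by (induction n) (simp_all add: mult.commute)

lemma const_in_int_valued: "[:to_fract c:] \<in> carrier int_valued_ring"
  by (simp add: int_valued_ring_def)

text \<open>A unit is already invertible among polynomials over a field, hence constant;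
  integer-valuedness puts it and its inverse into the base ring.\<close>

lemma Units_int_valued:
  "Units (int_valued_ring :: 'd::idom fract poly ring) = {[:to_fract u:] | u. u dvd 1}"
proof safe
  fix p :: "'d fract poly" assume "p \<in> Units int_valued_ring"
  then obtain r where p: "p \<in> carrier int_valued_ring" and r: "r \<in> carrier int_valued_ring"
      and pr: "p * r = 1"
    by (auto simp: Units_def)
  have "p dvd 1" "r dvd 1" using pr by (metis dvd_triv_left, metis dvd_triv_right)
  then obtain c e where ce: "p = [:c:]" "r = [:e:]" by (auto simp: is_unit_poly_iff)
  obtain u v where uv: "c = to_fract u" "e = to_fract v"
    using p r by (auto simp: int_valued_ring_def ce)
  have "to_fract (u * v) = to_fract 1" using pr by (simp add: ce uv one_pCons mult.commute)
  then have "u dvd 1" unfolding to_fract_eq_iff by (metis dvd_triv_left)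
  then show "\<exists>u. p = [:to_fract u:] \<and> u dvd 1" using ce uv by blast
next
  fix u :: 'd assume "u dvd 1"
  then obtain v where "1 = u * v" by blast
  then have "to_fract u * to_fract v = 1" by (metis to_fract_1 to_fract_mult)
  then have "[:to_fract u:] * [:to_fract v:] = 1" by (simp add: one_pCons mult.commute)
  moreover from this have "[:to_fract v:] * [:to_fract u:] = 1" by (subst mult.commute)
  ultimately show "[:to_fract u:] \<in> Units int_valued_ring"
    unfolding Units_def int_valued_ring_simps using const_in_int_valued by blast
qed

lemma degree_Units_int_valued: "p \<in> Units int_valued_ring \<Longrightarrow> degree p = 0"
  by (auto simp: Units_int_valued)

lemma carlitz_basis_not_unit: "carlitz_basis s \<notin> Units int_valued_ring"
  by (auto simp: degree_carlitz_basis dest!: degree_Units_int_valued)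

text \<open>Both factors are unit multiples of powers of \<open>carlitz_basis s\<close>; by degrees
  the exponents add up to 1, so one factor is a constant unit.\<close>

lemma ring_irreducible_carlitz_basis: "ring_irreducible\<^bsub>int_valued_ring\<^esub> (carlitz_basis s)"
proof (rule int_valued.ring_irreducibleI)
  fix g h :: "'a poly fract poly"
  assume gh: "g \<in> carrier int_valued_ring" "h \<in> carrier int_valued_ring"
    "carlitz_basis s = g \<otimes>\<^bsub>int_valued_ring\<^esub> h"
  let ?b = "carlitz_basis s :: 'a poly fract poly"
  \<comment> \<open>\<open>factor_of_carlitz_basis_power\<close> describes the left factor, so both
    orders are supplied.\<close>
  have eq: "g * h = ?b ^ 1" "h * g = ?b ^ 1" using gh(3) by (simp_all add: mult.commute)
  obtain u i where u: "u dvd 1" "g = smult (to_fract u) (?b ^ i)"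
    using factor_of_carlitz_basis_power[OF eq(1) gh(1,2)] by blast
  obtain v j where v: "v dvd 1" "h = smult (to_fract v) (?b ^ j)"
    using factor_of_carlitz_basis_power[OF eq(2) gh(2,1)] by blast
  have nz: "u \<noteq> 0" "v \<noteq> 0" using u(1) v(1) by auto
  have "g * h \<noteq> 0" using eq carlitz_basis_nonzero by simp
  then have "degree ?b = degree g + degree h"
    using eq(1) by (metis degree_mult_eq mult_eq_0_iff power_one_right)
  also have "\<dots> = (i + j) * degree ?b"
    using nz by (simp add: u v degree_power_eq carlitz_basis_nonzero algebra_simps)
  finally have "i + j = 1"
    by (simp add: degree_carlitz_basis)
  then have "i = 0 \<or> j = 0" by linarith
  then show "g \<in> Units int_valued_ring \<or> h \<in> Units int_valued_ring"
    using u v by (auto simp: Units_int_valued)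
qed (use carlitz_basis_in_carrier carlitz_basis_nonzero carlitz_basis_not_unit in auto)

text \<open>The exponent of \<open>carlitz_basis s\<close> in \<open>g\<close> is not 0, as
  \<open>g\<close> is no unit. Splitting off one copy leaves a cofactor that must be a unit, hence
  of degree 0, so the exponent is 1.\<close>

lemma irreducible_factor_of_carlitz_basis_power:
  fixes g h :: "'a::{field,finite} poly fract poly"
  assumes gh: "g * h = carlitz_basis s ^ m"
    and g: "g \<in> carrier int_valued_ring" and h: "h \<in> carrier int_valued_ring"
    and irr: "ring_irreducible\<^bsub>int_valued_ring\<^esub> g"
  shows "\<exists>u. u dvd 1 \<and> g = smult (to_fract u) (carlitz_basis s)"
proof -
  let ?b = "carlitz_basis s :: 'a poly fract poly"
  obtain u i where u: "u dvd 1" "g = smult (to_fract u) (?b ^ i)"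
    using factor_of_carlitz_basis_power[OF gh g h] by blast
  note irr = int_valued.ring_irreducibleE[OF g irr]
  have "i \<noteq> 0"
  proof
    assume "i = 0"
    with u have "g = [:to_fract u:]" by simp
    with irr(4) u(1) show False by (auto simp: Units_int_valued)
  qed
  then obtain j where j: "i = Suc j" by (cases i) auto
  have "[:to_fract u:] * ?b ^ j \<in> carrier int_valued_ring"
    by (intro mult_in_int_valued const_in_int_valued power_in_int_valued carlitz_basis_in_carrier)
  then have "smult (to_fract u) (?b ^ j) \<in> Units int_valued_ring"
    using irr(5)[OF carlitz_basis_in_carrier[of s], of "smult (to_fract u) (?b ^ j)"]
      u(2) j carlitz_basis_not_unit by auto
  then have "degree (smult (to_fract u) (?b ^ j)) = 0"
    by (rule degree_Units_int_valued)
  moreover have "u \<noteq> 0" using u(1) by auto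
  ultimately have "j = 0"
    by (simp add: degree_power_eq carlitz_basis_nonzero degree_carlitz_basis)
  then show ?thesis using u j by auto
qed

text \<open>Each entry becomes a left factor after reordering the product; comparing degrees then
  fixes the length of the list.\<close>

lemma irreducible_factorization_carlitz_basis_power:
  fixes fs :: "'a::{field,finite} poly fract poly list"
  assumes "irreducible_factorization int_valued_ring fs (carlitz_basis s ^ m)"
  shows "(\<forall>f\<in>set fs. \<exists>u. u dvd 1 \<and> f = smult (to_fract u) (carlitz_basis s)) \<and> length fs = m"
proof -
  let ?b = "carlitz_basis s :: 'a poly fract poly"
  have fs: "set fs \<subseteq> carrier int_valued_ring"
      "\<And>f. f \<in> set fs \<Longrightarrow> ring_irreducible\<^bsub>int_valued_ring\<^esub> f" "prod_list fs = ?b ^ m"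
    using assms by (auto simp: irreducible_factorization_def prod_list.eq_foldr)
  have assoc: "\<exists>u. u dvd 1 \<and> f = smult (to_fract u) ?b" if f: "f \<in> set fs" for f
  proof -
    obtain xs ys where split: "fs = xs @ f # ys" using f by (meson split_list)
    have "f * prod_list (xs @ ys) = ?b ^ m"
      using fs(3) by (simp add: split ac_simps)
    moreover have "prod_list (xs @ ys) \<in> carrier int_valued_ring"
      using fs(1) by (intro prod_list_in_int_valued) (auto simp: split)
    ultimately show ?thesis
      using irreducible_factor_of_carlitz_basis_power fs(1,2) f by blast
  qed
  have "degree f = degree ?b \<and> f \<noteq> 0" if "f \<in> set fs" for f
    using assoc[OF that] by (auto simp: carlitz_basis_nonzero)
  then have "degree (prod_list fs) = length fs * degree ?b \<and> prod_list fs \<noteq> 0"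
    by (induction fs) (auto simp: degree_mult_eq)
  then have "length fs = m"
    using fs(3) by (simp add: degree_power_eq carlitz_basis_nonzero degree_carlitz_basis)
  with assoc show ?thesis by blast
qed

lemma smult_unit_divides:
  fixes b :: "'d::idom fract poly"
  assumes "u dvd 1" "v dvd 1" "b \<in> carrier int_valued_ring"
  shows "smult (to_fract u) b divides\<^bsub>int_valued_ring\<^esub> smult (to_fract v) b"
proof -
  obtain w where "1 = u * w" using assms(1) by blast
  then have "v = u * (w * v)" by (metis mult.assoc mult_1_left)
  then have "to_fract v = to_fract u * to_fract (w * v)" by (metis to_fract_mult)
  then have "smult (to_fract v) b = smult (to_fract u) b * [:to_fract (w * v):]"
    by (simp add: mult.commute[of "to_fract u"] del: to_fract_mult)
  then show ?thesis
    unfolding factor_def int_valued_ring_simps using const_in_int_valued by blast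
qed

lemma factors_uniquely_carlitz_basis_power:
  "factors_uniquely int_valued_ring (carlitz_basis s ^ m)"
  unfolding factors_uniquely_def
proof (intro conjI allI impI)
  show "\<exists>fs. irreducible_factorization int_valued_ring fs (carlitz_basis s ^ m)"
    by (intro exI[of _ "replicate m (carlitz_basis s)"])
      (auto simp: irreducible_factorization_def prod_list.eq_foldr[symmetric]
        carlitz_basis_in_carrier ring_irreducible_carlitz_basis simp del: foldr_replicate)
next
  fix fs gs :: "'a poly fract poly list"
  assume fs: "irreducible_factorization int_valued_ring fs (carlitz_basis s ^ m)"
    and gs: "irreducible_factorization int_valued_ring gs (carlitz_basis s ^ m)"
  note fs = irreducible_factorization_carlitz_basis_power[OF fs]
  note gs = irreducible_factorization_carlitz_basis_power[OF gs]
  \<comment> \<open>All entries of both lists are associated to \<open>carlitz_basis s\<close>, so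
    the lists match position by position without a permutation.\<close>
  have "fs [\<sim>]\<^bsub>int_valued_ring\<^esub> gs"
  proof (rule list_all2_all_nthI)
    fix n assume n: "n < length fs"
    then have "fs ! n \<in> set fs" "gs ! n \<in> set gs" using fs gs by auto
    then obtain u v where "u dvd 1" "fs ! n = smult (to_fract u) (carlitz_basis s)"
        "v dvd 1" "gs ! n = smult (to_fract v) (carlitz_basis s)"
      using fs gs by blast
    then show "fs ! n \<sim>\<^bsub>int_valued_ring\<^esub> gs ! n"
      by (simp add: associated_def smult_unit_divides carlitz_basis_in_carrier)
  qed (use fs gs in simp)
  then show "essentially_equal int_valued_ring fs gs"
    unfolding essentially_equal_def by blast
qed

section \<open>Digit expansions\<close>

lemma digit_Suc: "digit q k (Suc i) = digit q (k div q) i"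
  by (simp add: digit_def div_mult2_eq)

lemma is_digit_expansion_Suc:
  assumes "is_digit_expansion q k (Suc s) \<alpha>"
  shows "is_digit_expansion q (k div q) s (\<lambda>i. \<alpha> (Suc i))" "k mod q = \<alpha> 0"
proof -
  have a: "\<alpha> 0 < q" "\<forall>i\<le>s. \<alpha> (Suc i) < q" "\<alpha> (Suc s) \<noteq> 0"
    using assms by (auto simp: is_digit_expansion_def)
  have "k = (\<Sum>i\<le>Suc s. \<alpha> i * q ^ i)"
    using assms by (simp add: is_digit_expansion_def)
  also have "\<dots> = \<alpha> 0 + q * (\<Sum>i\<le>s. \<alpha> (Suc i) * q ^ i)"
    by (subst sum.atMost_Suc_shift) (simp add: sum_distrib_left ac_simps)
  finally have k: "k = \<alpha> 0 + q * (\<Sum>i\<le>s. \<alpha> (Suc i) * q ^ i)" .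
  show "k mod q = \<alpha> 0" using a(1) by (simp add: k)
  show "is_digit_expansion q (k div q) s (\<lambda>i. \<alpha> (Suc i))"
    using a by (simp add: is_digit_expansion_def k)
qed

text \<open>Uniqueness of the digits: the lowest one is \<open>k mod q\<close>, and the others
  belong to \<open>k div q\<close>.\<close>

lemma digit_eq_digit_expansion:
  assumes "is_digit_expansion q k s \<alpha>"
  shows "digit q k i = (if i \<le> s then \<alpha> i else 0)"
  using assms
proof (induction s arbitrary: k \<alpha> i)
  case 0
  then have "k = \<alpha> 0" "\<alpha> 0 < q" by (auto simp: is_digit_expansion_def)
  then show ?case
    by (cases i) (auto simp: digit_def div_mult2_eq)
next
  case (Suc s)
  note E = is_digit_expansion_Suc[OF Suc.prems]
  show ?case
  proof (cases i)
    case 0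
    then show ?thesis using E(2) by (simp add: digit_def)
  next
    case (Suc j)
    then show ?thesis using Suc.IH[OF E(1), of j] by (simp add: digit_Suc)
  qed
qed

lemma ex_digit_expansion:
  assumes "q \<ge> 2" "k > 0"
  shows "\<exists>s \<alpha>. is_digit_expansion q k s \<alpha>"
  using assms(2)
proof (induction k rule: less_induct)
  case (less k)
  show ?case
  proof (cases "k < q")
    case True
    with less.prems show ?thesis
      by (intro exI[of _ 0] exI[of _ "\<lambda>_. k"]) (simp add: is_digit_expansion_def)
  next
    case False
    then have "k div q > 0" "k div q < k" using assms(1) by (auto simp: div_greater_zero_iff)
    with less.IH obtain s \<alpha> where E: "is_digit_expansion q (k div q) s \<alpha>" by blast
    define \<alpha>' where "\<alpha>' i = (case i of 0 \<Rightarrow> k mod q | Suc j \<Rightarrow> \<alpha> j)" for i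
    have "(\<Sum>i\<le>Suc s. \<alpha>' i * q ^ i) = k mod q + q * (\<Sum>i\<le>s. \<alpha> i * q ^ i)"
      by (subst sum.atMost_Suc_shift) (simp add: \<alpha>'_def sum_distrib_left ac_simps)
    also have "\<dots> = k mod q + q * (k div q)" using E by (simp add: is_digit_expansion_def)
    also have "\<dots> = k" by simp
    finally have "is_digit_expansion q k (Suc s) \<alpha>'"
      using E assms(1) by (auto simp: is_digit_expansion_def \<alpha>'_def split: nat.splits)
    then show ?thesis by blast
  qed
qed

section \<open>Factorization of the binomial polynomials along the digits\<close>

lemma carlitz_binomial_prod:
  fixes k :: nat
  shows "(carlitz_binomial k :: 'a::{field,finite} poly fract poly) =
    (\<Prod>i\<le>k. carlitz_basis i ^ digit CARD('a) k i)"
proof -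
  have "(\<Prod>i\<in>A. smult (c i) (p i)) = smult (prod c A) (prod p A)"
    for A and c :: "nat \<Rightarrow> 'a poly fract" and p
    by (induction A rule: infinite_finite_induct) (auto simp: mult.commute)
  then show ?thesis
    unfolding carlitz_binomial_def carlitz_G_def carlitz_g_def carlitz_basis_def smult_power
    by (simp add: to_fract_prod to_fract_power power_inverse flip: prod_inversef)
qed

lemma carlitz_binomial_digit_expansion:
  fixes k :: nat
  assumes "is_digit_expansion CARD('a) k s \<alpha>"
  shows "(carlitz_binomial k :: 'a::{field,finite} poly fract poly) = (\<Prod>i\<le>s. carlitz_basis i ^ \<alpha> i)"
proof -
  \<comment> \<open>The product in \<open>carlitz_binomial\<close> runs up to \<open>k\<close>; the
    bound \<open>s < k\<close> makes it cover all positions up to \<open>s\<close>, and the later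
    digits are 0.\<close>
  have "s < CARD('a) ^ s" using card_ge_2[where 'a = 'a] by (intro power_gt_expt) auto
  also have "\<dots> \<le> \<alpha> s * CARD('a) ^ s" using assms by (simp add: is_digit_expansion_def)
  also have "\<dots> \<le> (\<Sum>i\<le>s. \<alpha> i * CARD('a) ^ i)" by (rule member_le_sum) auto
  also have "\<dots> = k" using assms by (simp add: is_digit_expansion_def)
  finally have "s < k" .
  have "(\<Prod>i\<le>k. carlitz_basis i ^ digit CARD('a) k i) = (\<Prod>i\<le>s. carlitz_basis i ^ \<alpha> i :: 'a poly fract poly)"
    by (rule prod.mono_neutral_cong_right)
      (use \<open>s < k\<close> in \<open>auto simp: digit_eq_digit_expansion[OF assms]\<close>)
  then show ?thesis by (simp add: carlitz_binomial_prod)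
qed

lemma carlitz_binomial_power_card:
  "carlitz_binomial (CARD('a) ^ s) = (carlitz_basis s :: 'a::{field,finite} poly fract poly)"
proof -
  let ?\<alpha> = "\<lambda>i. if i = s then 1 else 0 :: nat"
  have "is_digit_expansion CARD('a) (CARD('a) ^ s) s ?\<alpha>"
    using card_ge_2[where 'a = 'a] by (auto simp: is_digit_expansion_def if_distrib if_distribR cong: if_cong)
  then have "carlitz_binomial (CARD('a) ^ s) = (\<Prod>i\<le>s. carlitz_basis i ^ ?\<alpha> i :: 'a poly fract poly)"
    by (rule carlitz_binomial_digit_expansion)
  also have "\<dots> = carlitz_basis s"
    by (simp add: if_distrib cong: if_cong)
  finally show ?thesis .
qed

text \<open>The leading digit is positive, so one factor \<open>carlitz_basis s\<close> splits off.
  It is no unit, so the cofactor is one and has degree 0.\<close>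

lemma irreducible_carlitz_binomialD:
  assumes "ring_irreducible\<^bsub>int_valued_ring\<^esub> (carlitz_binomial k :: 'a::{field,finite} poly fract poly)"
    and E: "is_digit_expansion CARD('a) k s \<alpha>"
  shows "k = CARD('a) ^ s"
proof -
  let ?b = "carlitz_basis :: nat \<Rightarrow> 'a poly fract poly"
  let ?r = "?b s ^ (\<alpha> s - 1) * (\<Prod>i<s. ?b i ^ \<alpha> i)"
  have "\<alpha> s > 0" using E by (simp add: is_digit_expansion_def)
  then have "?b s ^ \<alpha> s = ?b s * ?b s ^ (\<alpha> s - 1)"
    by (metis Suc_pred' power_Suc)
  then have k: "carlitz_binomial k = ?b s * ?r"
    unfolding carlitz_binomial_digit_expansion[OF E] lessThan_Suc_atMost[symmetric] prod.lessThan_Suc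
    by (simp only: ac_simps)
  have r: "?r \<in> carrier int_valued_ring"
    by (intro mult_in_int_valued prod_in_int_valued power_in_int_valued carlitz_basis_in_carrier)
  then have "carlitz_binomial k \<in> carrier (int_valued_ring :: 'a poly fract poly ring)"
    unfolding k by (rule mult_in_int_valued[OF carlitz_basis_in_carrier])
  from int_valued.ring_irreducibleE(5)[OF this assms(1) carlitz_basis_in_carrier r]
  have "?r \<in> Units int_valued_ring"
    using k carlitz_basis_not_unit by auto
  then have "degree ?r = 0" by (rule degree_Units_int_valued)
  \<comment> \<open>This degree equals k - q^s; its vanishing forces leading digit 1 and all lower
    terms 0.\<close>
  moreover have "degree ?r = (\<alpha> s - 1) * CARD('a) ^ s + (\<Sum>i<s. \<alpha> i * CARD('a) ^ i)"
    by (subst degree_mult_eq)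
      (auto simp: degree_prod_eq_sum_degree degree_power_eq degree_carlitz_basis carlitz_basis_nonzero)
  ultimately have *: "\<alpha> s - 1 = 0" "(\<Sum>i<s. \<alpha> i * CARD('a) ^ i) = 0"
    by auto
  have "k = (\<Sum>i<s. \<alpha> i * CARD('a) ^ i) + \<alpha> s * CARD('a) ^ s"
    using E by (simp add: is_digit_expansion_def flip: lessThan_Suc_atMost)
  with * \<open>\<alpha> s > 0\<close> show ?thesis
    by (metis Suc_pred' add_0 mult_1 One_nat_def)
qed

theorem theorem1p2:
  fixes \<beta> :: "nat \<Rightarrow> 'a::{field,finite} poly fract poly"
    and R :: "'a poly fract poly ring"
    and q k :: nat
  assumes "q = CARD('a)"
    and "R = int_valued_ring"
    and "\<beta> = carlitz_binomial"
    and "k > 0"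
  shows "(\<forall>n. \<beta> n \<in> carrier R) \<and>
    (ring_irreducible\<^bsub>R\<^esub> (\<beta> k) \<longleftrightarrow> (\<exists>s. k = q ^ s)) \<and>
    (\<exists>s \<alpha>. is_digit_expansion q k s \<alpha>) \<and>
    (\<forall>s \<alpha>. is_digit_expansion q k s \<alpha> \<longrightarrow> \<beta> k = (\<Prod>i\<le>s. \<beta> (q ^ i) ^ \<alpha> i)) \<and>
    (\<forall>s m::nat. m > 0 \<longrightarrow> factors_uniquely R (\<beta> (q ^ s) [^]\<^bsub>R\<^esub> m)) \<and>
    (\<forall>s. absolutely_irreducible R (\<beta> (q ^ s)))"
proof -
  note [simp] = assms(1-3) carlitz_binomial_power_card
  have carrier: "\<beta> n \<in> carrier R" for n
    by (auto simp: carlitz_binomial_prod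
        intro!: prod_in_int_valued power_in_int_valued carlitz_basis_in_carrier)
  have ex: "\<exists>s \<alpha>. is_digit_expansion q k s \<alpha>"
    using ex_digit_expansion[OF card_ge_2 assms(4)] by simp
  \<comment> \<open>One direction applies the degree argument to some digit expansion; in the other,
    \<open>\<beta> (q ^ s)\<close> is \<open>carlitz_basis s\<close>.\<close>
  then have irr: "ring_irreducible\<^bsub>R\<^esub> (\<beta> k) \<longleftrightarrow> (\<exists>s. k = q ^ s)"
    using irreducible_carlitz_binomialD ring_irreducible_carlitz_basis by fastforce
  have uniq: "factors_uniquely R (\<beta> (q ^ s) [^]\<^bsub>R\<^esub> m)" for s m :: nat
    by (simp add: int_valued_pow factors_uniquely_carlitz_basis_power)
  have "absolutely_irreducible R (\<beta> (q ^ s))" for s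
    using carrier[of "q ^ s"] uniq
    by (auto simp: absolutely_irreducible_def ring_irreducible_carlitz_basis)
  then show ?thesis
    using carrier ex irr uniq by (auto dest: carlitz_binomial_digit_expansion)
qed

end
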